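(* For any non-empty set $X$, the lattice $\mathbf{Sub}(\mathbb{M}_X)$ is not modular.
   Context: For a non-empty set $X$, put $X_1=X$ and $X_n=\bigcup_{k=1}^{n-1}X_k\times X_{n-k}$ for $n>1$ (regarded as pairwise disjoint sets of formal pairs); the free magma on $X$ is $\mathbb{M}_X=\bigcup_{n\ge1}X_n$ with $x+y=(x,y)$. A submagma is a subset closed under $+$, and the empty set is counted as a submagma. $\mathbf{Sub}(\mathbb{M}_X)$ is the lattice of all submagmas of $\mathbb{M}_X$ with meet $\cap$ and join $N\vee N'=\langle N\cup N'\rangle$ (the submagma generated by $N\cup N'$). *)

theory Defs
  imports "HOL-Algebra.Lattice" "HOL.Hull"
begin

section \<open>The free magma\<close>

text \<open>
  \<open>Plus s t\<close> is the formal pair \<open>(s, t)\<close> and \<open>Gen x\<close> is \<open>x\<close> regarded as an element of \<open>X\<^sub>1\<close>.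
  The datatype supplies the formal pairs, which makes the levels below pairwise disjoint.
\<close>

datatype 'a magma_term = Gen 'a | Plus "'a magma_term" "'a magma_term"

text \<open>\<open>magma_level X n\<close> is \<open>X\<^sub>n\<close>; the value at \<open>0\<close> is a dummy.\<close>

fun magma_level :: "'a set \<Rightarrow> nat \<Rightarrow> 'a magma_term set" where
  "magma_level X n =
     (if n = 0 then {}
      else if n = 1 then Gen ` X
      else \<Union>k\<in>{1..<n}. (\<lambda>(s, t). Plus s t) ` (magma_level X k \<times> magma_level X (n - k)))"

declare magma_level.simps [simp del]

definition free_magma :: "'a set \<Rightarrow> 'a magma_term set" where
  "free_magma X = (\<Union>n\<in>{1..}. magma_level X n)"


section \<open>The lattice of submagmas\<close>

definition submagma :: "'a set \<Rightarrow> 'a magma_term set \<Rightarrow> bool" where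
  "submagma X N \<longleftrightarrow> N \<subseteq> free_magma X \<and> (\<forall>s\<in>N. \<forall>t\<in>N. Plus s t \<in> N)"

definition generated_submagma :: "'a set \<Rightarrow> 'a magma_term set \<Rightarrow> 'a magma_term set" where
  "generated_submagma X S = submagma X hull S"

definition Sub :: "'a set \<Rightarrow> 'a magma_term set gorder" where
  "Sub X = \<lparr>carrier = {N. submagma X N}, eq = (=), le = (\<subseteq>)\<rparr>"

locale modular_lattice = lattice +
  assumes modular_law:
    "\<lbrakk>x \<in> carrier L; y \<in> carrier L; z \<in> carrier L; x \<sqsubseteq> z\<rbrakk>
       \<Longrightarrow> x \<squnion> (y \<sqinter> z) = (x \<squnion> y) \<sqinter> z"


section \<open>Meet and join of submagmas\<close>

lemma Gen_in_free_magma: "Gen x \<in> free_magma X \<longleftrightarrow> x \<in> X"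
proof
  assume "Gen x \<in> free_magma X"
  then obtain n where "Gen x \<in> magma_level X n"
    by (auto simp: free_magma_def)
  then show "x \<in> X"
    by (subst (asm) magma_level.simps) (auto split: if_splits)
next
  assume "x \<in> X"
  then have "Gen x \<in> magma_level X 1"
    by (subst magma_level.simps) auto
  then show "Gen x \<in> free_magma X"
    by (auto simp: free_magma_def)
qed

lemma Plus_in_free_magma:
  "Plus s t \<in> free_magma X \<longleftrightarrow> s \<in> free_magma X \<and> t \<in> free_magma X"
proof
  assume "Plus s t \<in> free_magma X"
  then obtain n where "Plus s t \<in> magma_level X n"
    by (auto simp: free_magma_def)
  then obtain k where "1 \<le> k" "k < n" "s \<in> magma_level X k" "t \<in> magma_level X (n - k)"
    by (subst (asm) magma_level.simps) (auto split: if_splits)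
  moreover from this have "1 \<le> n - k"
    by simp
  ultimately show "s \<in> free_magma X \<and> t \<in> free_magma X"
    unfolding free_magma_def by blast
next
  assume "s \<in> free_magma X \<and> t \<in> free_magma X"
  then obtain k m where k: "1 \<le> k" "s \<in> magma_level X k" and m: "1 \<le> m" "t \<in> magma_level X m"
    by (auto simp: free_magma_def)
  then have "Plus s t \<in> magma_level X (k + m)"
    by (subst magma_level.simps) (auto intro!: bexI[of _ k])
  with k show "Plus s t \<in> free_magma X"
    unfolding free_magma_def by (intro UN_I[of "k + m"]) auto
qed

lemma submagma_empty: "submagma X {}"
  by (simp add: submagma_def)

lemma submagma_free_magma: "submagma X (free_magma X)"
  by (simp add: submagma_def Plus_in_free_magma)

lemma submagma_Int: "submagma X N \<Longrightarrow> submagma X N' \<Longrightarrow> submagma X (N \<inter> N')"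
  by (auto simp: submagma_def)

lemma submagma_generated:
  assumes "S \<subseteq> free_magma X"
  shows "submagma X (generated_submagma X S)"
proof -
  have "generated_submagma X S \<subseteq> free_magma X"
    unfolding generated_submagma_def using assms submagma_free_magma by (rule hull_minimal)
  then show ?thesis
    by (auto simp: submagma_def generated_submagma_def hull_def)
qed

lemma Sub_simps [simp]:
  "carrier (Sub X) = {N. submagma X N}"
  "N \<sqsubseteq>\<^bsub>Sub X\<^esub> N' \<longleftrightarrow> N \<subseteq> N'"
  "N .=\<^bsub>Sub X\<^esub> N' \<longleftrightarrow> N = N'"
  by (simp_all add: Sub_def)

lemma least_Upper_Sub:
  assumes "submagma X N" "submagma X N'"
  shows "least (Sub X) (generated_submagma X (N \<union> N')) (Upper (Sub X) {N, N'})"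
proof (rule least_UpperI)
  have sub: "N \<union> N' \<subseteq> free_magma X"
    using assms by (auto simp: submagma_def)
  show "generated_submagma X (N \<union> N') \<in> carrier (Sub X)"
    using submagma_generated[OF sub] by simp
  have "N \<union> N' \<subseteq> generated_submagma X (N \<union> N')"
    unfolding generated_submagma_def by (rule hull_subset)
  then show "M \<sqsubseteq>\<^bsub>Sub X\<^esub> generated_submagma X (N \<union> N')" if "M \<in> {N, N'}" for M
    using that by auto
  show "generated_submagma X (N \<union> N') \<sqsubseteq>\<^bsub>Sub X\<^esub> M" if "M \<in> Upper (Sub X) {N, N'}" for M
  proof -
    from that assms have "N \<union> N' \<subseteq> M" "submagma X M"
      by (auto simp: Upper_def)
    then show ?thesis
      by (simp add: generated_submagma_def hull_minimal)
  qed
  show "{N, N'} \<subseteq> carrier (Sub X)"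
    using assms by simp
qed

lemma greatest_Lower_Sub:
  assumes "submagma X N" "submagma X N'"
  shows "greatest (Sub X) (N \<inter> N') (Lower (Sub X) {N, N'})"
  using assms by (intro greatest_LowerI) (auto simp: Lower_def submagma_Int)

lemma lattice_Sub: "lattice (Sub X)"
proof -
  interpret partial_order "Sub X"
    by unfold_locales (auto simp: Sub_def)
  show ?thesis
    by unfold_locales (auto intro: least_Upper_Sub greatest_Lower_Sub)
qed

lemma join_Sub:
  assumes "submagma X N" "submagma X N'"
  shows "N \<squnion>\<^bsub>Sub X\<^esub> N' = generated_submagma X (N \<union> N')"
proof -
  interpret lattice "Sub X"
    by (rule lattice_Sub)
  show ?thesis
    unfolding join_def sup_def
    using least_Upper_Sub[OF assms] by (rule some_equality) (rule least_unique[OF _ least_Upper_Sub[OF assms]])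
qed

lemma meet_Sub:
  assumes "submagma X N" "submagma X N'"
  shows "N \<sqinter>\<^bsub>Sub X\<^esub> N' = N \<inter> N'"
proof -
  interpret lattice "Sub X"
    by (rule lattice_Sub)
  show ?thesis
    unfolding meet_def inf_def
    using greatest_Lower_Sub[OF assms] by (rule some_equality) (rule greatest_unique[OF _ greatest_Lower_Sub[OF assms]])
qed

end

(* Fix a generator a and put u = a + a, v = a + (a + a), w = u + v.  The elements with at least four
   generators, other than w, can be adjoined to each of {u}, {v} and {u, w}: a sum formed
   inside one of these sets has at least four generators, and it is w only if the summands are
   u and v.  The resulting submagmas x, y, z satisfy x \<le> z and y \<inter> z \<le> x, but w belongs to
   (x \<squnion> y) \<sqinter> z and not to x. *)

theory Submission
  imports Defs
begin

text \<open>Since \<open>M \<inter> P \<subseteq> N\<close>, the left side of the modular law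
  collapses to \<open>N\<close>, while its right side contains \<open>Plus s t\<close>.\<close>

lemma Sub_not_modularI:
  assumes sub: "submagma X N" "submagma X M" "submagma X P"
    and "N \<subseteq> P" "M \<inter> P \<subseteq> N" "s \<in> N" "t \<in> M" "Plus s t \<in> P" "Plus s t \<notin> N"
  shows "\<not> modular_lattice (Sub X)"
proof
  assume "modular_lattice (Sub X)"
  then interpret modular_lattice "Sub X" .
  have MP: "submagma X (M \<inter> P)"
    using sub by (simp add: submagma_Int)
  have "N \<union> M \<subseteq> free_magma X"
    using sub by (auto simp: submagma_def)
  then have NM: "submagma X (generated_submagma X (N \<union> M))"
    by (rule submagma_generated)
  have "N \<union> M \<subseteq> generated_submagma X (N \<union> M)"
    unfolding generated_submagma_def by (rule hull_subset)
  then have "Plus s t \<in> generated_submagma X (N \<union> M)"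
    using NM \<open>s \<in> N\<close> \<open>t \<in> M\<close> unfolding submagma_def by blast
  moreover have "generated_submagma X (N \<union> (M \<inter> P)) \<subseteq> N"
    unfolding generated_submagma_def using assms by (intro hull_minimal) auto
  moreover have "generated_submagma X (N \<union> (M \<inter> P)) = generated_submagma X (N \<union> M) \<inter> P"
    using modular_law[of N M P] sub \<open>N \<subseteq> P\<close> MP NM by (simp add: join_Sub meet_Sub)
  ultimately show False
    using \<open>Plus s t \<in> P\<close> \<open>Plus s t \<notin> N\<close> by blast
qed

theorem corollary5p3:
  fixes X :: "'a set"
  assumes "X \<noteq> {}"
  shows "lattice (Sub X) \<and> \<not> modular_lattice (Sub X)"
proof
  show "lattice (Sub X)"
    by (rule lattice_Sub)
  obtain a where "a \<in> X"
    using assms by blast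
  define u where "u = Plus (Gen a) (Gen a)"
  define v where "v = Plus (Gen a) u"
  define w where "w = Plus u v"
  \<comment> \<open>An element with \<open>n\<close> generators has \<open>size\<close> equal to \<open>2 * n - 1\<close>.\<close>
  define B where "B = {t \<in> free_magma X. 7 \<le> size t \<and> t \<noteq> w}"
  have free: "u \<in> free_magma X" "v \<in> free_magma X" "w \<in> free_magma X"
    using \<open>a \<in> X\<close> by (simp_all add: u_def v_def w_def Gen_in_free_magma Plus_in_free_magma)
  have size: "size u = 3" "size v = 5" "size w = 9"
    by (simp_all add: u_def v_def w_def)
  have distinct: "u \<noteq> v" "v \<noteq> u" "w \<noteq> u" "u \<noteq> w" "w \<noteq> v" "v \<noteq> w"
    using size by auto
  \<comment> \<open>By freeness, \<open>w\<close> splits as a sum in only one way.\<close>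
  have Plus_w: "Plus s t = w \<longleftrightarrow> s = u \<and> t = v" for s t
    by (simp add: w_def)
  \<comment> \<open>All members have size at least 3, so sums have size at least 7. As
    \<open>u\<close> and \<open>v\<close> are too small for \<open>B\<close>, no set contains both,
    and \<open>w\<close> never arises as a sum.\<close>
  have sub: "submagma X (insert u B)" "submagma X (insert v B)" "submagma X (insert u (insert w B))"
    using free
    by (auto simp: size distinct submagma_def B_def Plus_in_free_magma Plus_w)
  show "\<not> modular_lattice (Sub X)"
  proof (rule Sub_not_modularI[OF sub])
    show "insert v B \<inter> insert u (insert w B) \<subseteq> insert u B"
      using distinct by auto
    show "Plus u v \<in> insert u (insert w B)" "Plus u v \<notin> insert u B"
      using distinct by (auto simp: w_def B_def)
  qed auto
qed

end
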